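(* Let $RSC_n=RSC(n,p_1,p_2,p_3)$ be a random spiro chain and let $M2_n=\sum_{uv\in E(RSC_n)}d_ud_v$ be the second Zagreb index of $RSC_n$, with $n\ge2$. Then $$M2_n=4X+40n-16,$$ $$\mathbb{E}(M2_n)=(4p_1+40)n-8p_1-16,$$ $$V(M2_n)=16p_1(1-p_1)(n-2),$$ where $X$ is a random variable having the binomial distribution with parameters $n-2$ and $p_1$; moreover, as $n\to\infty$, $$\frac{M2_n-\mathbb{E}(M2_n)}{\sqrt{V(M2_n)}}\xrightarrow{D}N(0,1).$$ Here $\mathbb{E}$ and $V$ denote expectation and variance, $\xrightarrow{D}$ convergence in distribution, and $N(0,1)$ the standard normal distribution.
   Context: For a finite simple graph $G$, $E(G)$ is its edge set and $d_v$ is the degree of the vertex $v$. Random spiro chain. Fix $p_1,p_2,p_3$ with $0<p_i<1$ and $p_1+p_2+p_3=1$. The random spiro chain $RSC_n=RSC(n,p_1,p_2,p_3)$ with $n$ hexagons is built as follows. $RSC_1$ is a hexagon $H_1$ (a 6-cycle). $RSC_2$ consists of two hexagons $H_1,H_2$ sharing exactly one vertex. For $n>2$, $RSC_n$ is obtained from $RSC_{n-1}$ by attaching a new hexagon $H_n$ to the last hexagon $H_{n-1}$, identifying one vertex of $H_n$ with a vertex $w$ of $H_{n-1}$, where $w$ is at distance $i\in\{1,2,3\}$ (in the 6-cycle $H_{n-1}$) from the vertex that $H_{n-1}$ shares with $H_{n-2}$. Case $i$ is chosen with probability $p_i$, independently of the previous choices. The first identity asserts that such a random variable $X$ exists (on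 the same probability space as the chain). *)

theory Defs
  imports "HOL-Probability.Probability"
begin

text \<open>
  A simple graph is given by its vertex set and its set of edges, each edge \<open>uv\<close> being the
  two-element set \<open>{u, v}\<close>.
\<close>

record 'v sgraph =
  verts :: "'v set"
  edges :: "'v set set"

definition simple_graph :: "'v sgraph \<Rightarrow> bool" where
  "simple_graph G \<longleftrightarrow> finite (verts G) \<and> (\<forall>e\<in>edges G. e \<subseteq> verts G \<and> card e = 2)"

definition degree :: "'v sgraph \<Rightarrow> 'v \<Rightarrow> nat" where
  "degree G v = card {e \<in> edges G. v \<in> e}"

text \<open>
  For an edge \<open>e = {u, v}\<close> with \<open>u \<noteq> v\<close> the inner product is \<open>degree G u * degree G v\<close>.
\<close>

definition second_zagreb :: "'v sgraph \<Rightarrow> nat" where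
  "second_zagreb G = (\<Sum>e\<in>edges G. \<Prod>v\<in>e. degree G v)"

definition graph_union :: "'v sgraph \<Rightarrow> 'v sgraph \<Rightarrow> 'v sgraph" where
  "graph_union G H = \<lparr>verts = verts G \<union> verts H, edges = edges G \<union> edges H\<rparr>"

definition adj_rel :: "'v sgraph \<Rightarrow> ('v \<times> 'v) set" where
  "adj_rel G = {(u, v). {u, v} \<in> edges G}"

text \<open>
  A pair belongs to \<open>adj_rel G ^^ k\<close> iff it is joined by a walk of length \<open>k\<close>. The
  distance is only meaningful for vertices in the same connected component.
\<close>

definition graph_dist :: "'v sgraph \<Rightarrow> 'v \<Rightarrow> 'v \<Rightarrow> nat" where
  "graph_dist G u v = (LEAST k. (u, v) \<in> adj_rel G ^^ k)"

definition hexagon :: "'v sgraph \<Rightarrow> bool" where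
  "hexagon G \<longleftrightarrow> (\<exists>vs. length vs = 6 \<and> distinct vs \<and> verts G = set vs \<and>
     edges G = {{vs ! i, vs ! ((i + 1) mod 6)} | i. i < 6})"

text \<open>
  \<open>spiro_chain c G\<close>: the graphs \<open>G 1, G 2, \<dots>\<close> are the successive stages of a spiro chain whose
  \<open>n\<close>-th hexagon (\<open>n > 2\<close>) is attached according to case \<open>c n\<close>. Here \<open>H n\<close> is the \<open>n\<close>-th hexagon
  and \<open>w n\<close> is the vertex that it shares with \<open>H (n - 1)\<close>. When two vertices of \<open>H (n - 1)\<close> are at
  the prescribed distance, either may be taken. Identifying a vertex of a new hexagon with \<open>w n\<close> is
  expressed by letting the new hexagon meet the previous graph exactly in \<open>w n\<close>.
  The value \<open>G 0\<close> is irrelevant.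
\<close>

definition spiro_chain :: "(nat \<Rightarrow> nat) \<Rightarrow> (nat \<Rightarrow> 'v sgraph) \<Rightarrow> bool" where
  "spiro_chain c G \<longleftrightarrow> (\<exists>H w.
     (\<forall>n\<ge>1. hexagon (H n)) \<and>
     G 1 = H 1 \<and>
     (\<forall>n\<ge>2. w n \<in> verts (H (n - 1)) \<and>
            verts (G (n - 1)) \<inter> verts (H n) = {w n} \<and>
            G n = graph_union (G (n - 1)) (H n)) \<and>
     (\<forall>n\<ge>3. graph_dist (H (n - 1)) (w (n - 1)) (w n) = c n))"

text \<open>
  The random spiro chain as a process on a probability space \<open>M\<close>: \<open>RSC n \<omega>\<close> is the chain with \<open>n\<close>
  hexagons, and \<open>c n\<close> (\<open>n > 2\<close>) is the random case used when attaching the \<open>n\<close>-th hexagon. Using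
  \<open>count_space {1, 2, 3}\<close> as target space makes \<open>c n\<close> take values in \<open>{1, 2, 3}\<close> on \<open>space M\<close>.
\<close>

definition random_spiro_chain ::
  "'a measure \<Rightarrow> real \<Rightarrow> real \<Rightarrow> real \<Rightarrow> (nat \<Rightarrow> 'a \<Rightarrow> 'v sgraph) \<Rightarrow> bool" where
  "random_spiro_chain M p\<^sub>1 p\<^sub>2 p\<^sub>3 RSC \<longleftrightarrow> prob_space M \<and>
     (\<exists>c. prob_space.indep_vars M (\<lambda>_. count_space {1, 2, 3}) c {3..} \<and>
        (\<forall>n\<ge>3. measure M {\<omega>\<in>space M. c n \<omega> = 1} = p\<^sub>1 \<and>
               measure M {\<omega>\<in>space M. c n \<omega> = 2} = p\<^sub>2 \<and>
               measure M {\<omega>\<in>space M. c n \<omega> = 3} = p\<^sub>3) \<and>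
        (\<forall>\<omega>\<in>space M. spiro_chain (\<lambda>n. c n \<omega>) (\<lambda>n. RSC n \<omega>)))"

text \<open>Sanity checks: the graphs occurring in a spiro chain are simple, and random spiro chains exist.\<close>

lemma hexagon_simple: "hexagon G \<Longrightarrow> simple_graph G"
proof -
  assume "hexagon G"
  then obtain vs where vs: "length vs = 6" "distinct vs" "verts G = set vs"
    "edges G = {{vs ! i, vs ! ((i + 1) mod 6)} | i. i < 6}"
    unfolding hexagon_def by blast
  have "{vs ! i, vs ! ((i + 1) mod 6)} \<subseteq> set vs \<and> card {vs ! i, vs ! ((i + 1) mod 6)} = 2"
    if "i < 6" for i
  proof -
    have "(i + 1) mod 6 < 6" "(i + 1) mod 6 \<noteq> i"
      using that by (cases "i = 5"; simp)+
    with vs that show ?thesis by (simp add: nth_eq_iff_index_eq)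
  qed
  with vs show ?thesis unfolding simple_graph_def by auto
qed

lemma spiro_chain_simple:
  assumes "spiro_chain c G" "n \<ge> 1"
  shows "simple_graph (G n)"
proof -
  from assms(1) obtain H w where H: "\<forall>n\<ge>1. hexagon (H n)" "G 1 = H 1"
    "\<forall>n\<ge>2. w n \<in> verts (H (n - 1)) \<and> verts (G (n - 1)) \<inter> verts (H n) = {w n} \<and>
            G n = graph_union (G (n - 1)) (H n)"
    unfolding spiro_chain_def by blast
  from assms(2) show ?thesis
  proof (induction n rule: dec_induct)
    case base
    with H show ?case by (metis hexagon_simple order_refl)
  next
    case (step n)
    have "simple_graph (H (Suc n))" using H(1) by (simp add: hexagon_simple)
    moreover have "G (Suc n) = graph_union (G n) (H (Suc n))"
      using H(3)[rule_format, of "Suc n"] step by simp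
    ultimately show ?case using step unfolding simple_graph_def graph_union_def by auto
  qed
qed

definition hexagon_of :: "'v list \<Rightarrow> 'v sgraph" where
  "hexagon_of vs = \<lparr>verts = set vs, edges = {{vs ! i, vs ! ((i + 1) mod 6)} | i. i < 6}\<rparr>"

lemma dist_hexagon_of:
  assumes d: "distinct [x0, x1, x2, x3, x4, x5]" and "k \<in> {1, 2, 3}"
  shows "graph_dist (hexagon_of [x0, x1, x2, x3, x4, x5]) x0 ([x0, x1, x2, x3, x4, x5] ! k) = k"
proof -
  let ?vs = "[x0, x1, x2, x3, x4, x5]"
  let ?A = "adj_rel (hexagon_of ?vs)"
  have "{i::nat. i < 6} = {0, 1, 2, 3, 4, 5}" by auto
  moreover have "edges (hexagon_of ?vs) = (\<lambda>i. {?vs ! i, ?vs ! ((i + 1) mod 6)}) ` {i. i < 6}"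
    by (auto simp: hexagon_of_def)
  ultimately have E: "edges (hexagon_of ?vs) = {{x0,x1}, {x1,x2}, {x2,x3}, {x3,x4}, {x4,x5}, {x5,x0}}"
    by simp
  have d': "distinct [x5, x4, x3, x2, x1, x0]"
    using d distinct_rev[of ?vs] by (simp only: rev.simps append.simps)
  have A: "(a, b) \<in> ?A \<longleftrightarrow>
      a = x0 \<and> b = x1 \<or> a = x1 \<and> b = x0 \<or> a = x1 \<and> b = x2 \<or> a = x2 \<and> b = x1 \<or>
      a = x2 \<and> b = x3 \<or> a = x3 \<and> b = x2 \<or> a = x3 \<and> b = x4 \<or> a = x4 \<and> b = x3 \<or>
      a = x4 \<and> b = x5 \<or> a = x5 \<and> b = x4 \<or> a = x5 \<and> b = x0 \<or> a = x0 \<and> b = x5" for a b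
    unfolding adj_rel_def E by (simp add: doubleton_eq_iff disj_assoc)
  have N: "(x0, b) \<in> ?A \<longleftrightarrow> b = x1 \<or> b = x5" "(x1, b) \<in> ?A \<longleftrightarrow> b = x0 \<or> b = x2"
    "(x2, b) \<in> ?A \<longleftrightarrow> b = x1 \<or> b = x3" "(x4, b) \<in> ?A \<longleftrightarrow> b = x3 \<or> b = x5"
    "(x5, b) \<in> ?A \<longleftrightarrow> b = x4 \<or> b = x0" for b
    unfolding A using d d' by simp_all
  have A0: "(x0, b) \<in> ?A ^^ 0 \<longleftrightarrow> b = x0" for b
    by auto
  have A1: "(x0, b) \<in> ?A ^^ 1 \<longleftrightarrow> b = x1 \<or> b = x5" for b
    by (simp add: N)
  have "(x0, b) \<in> ?A ^^ 2 \<longleftrightarrow> (\<exists>y. (x0, y) \<in> ?A \<and> (y, b) \<in> ?A)" for b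
    by (simp add: numeral_2_eq_2 relcomp_unfold)
  then have A2: "(x0, b) \<in> ?A ^^ 2 \<longleftrightarrow> b = x0 \<or> b = x2 \<or> b = x4" for b
    unfolding N(1) by (simp add: conj_disj_distribR ex_disj_distrib N(2,5)) blast
  have "(x0, b) \<in> ?A ^^ 3 \<longleftrightarrow> (\<exists>y. (x0, y) \<in> ?A ^^ 2 \<and> (y, b) \<in> ?A)" for b
    by (simp add: numeral_3_eq_3 numeral_2_eq_2 relcomp_unfold)
  then have A3: "(x0, x3) \<in> ?A ^^ 3"
    unfolding A2 using N(3) by blast
  have ne: "x1 \<noteq> x0" "x2 \<noteq> x0" "x2 \<noteq> x1" "x2 \<noteq> x5" "x3 \<noteq> x0" "x3 \<noteq> x1" "x3 \<noteq> x5" "x3 \<noteq> x2" "x3 \<noteq> x4"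
    using d d' by simp_all
  have walk: "(x0, ?vs ! k) \<in> ?A ^^ k"
    using assms(2)
  proof (elim insertE emptyE)
    assume "k = 1" then show ?thesis using A1[of x1] by simp
  next
    assume "k = 2" then show ?thesis using A2[of x2] by simp
  next
    assume "k = 3" then show ?thesis using A3 by simp
  qed
  have no_walk: "(x0, ?vs ! k) \<notin> ?A ^^ j" if "j < k" for j
    using assms(2)
  proof (elim insertE emptyE)
    assume [simp]: "k = 1"
    with that have "j = 0" by simp
    then show ?thesis using A0[of x1] ne by simp
  next
    assume [simp]: "k = 2"
    with that have "j = 0 \<or> j = 1" by auto
    then show ?thesis using A0[of x2] A1[of x2] ne by auto
  next
    assume [simp]: "k = 3"
    with that have "j = 0 \<or> j = 1 \<or> j = 2" by auto
    then show ?thesis using A0[of x3] A1[of x3] A2[of x3] ne by auto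
  qed
  show ?thesis unfolding graph_dist_def
  proof (rule Least_equality)
    show "(x0, ?vs ! k) \<in> ?A ^^ k" by (rule walk)
    show "k \<le> j" if "(x0, ?vs ! k) \<in> ?A ^^ j" for j
      using that no_walk[of j] by (metis not_le)
  qed
qed

lemma spiro_chain_exists:
  "\<exists>G :: (nat \<Rightarrow> nat) \<Rightarrow> nat \<Rightarrow> nat sgraph.
     \<forall>c. (\<forall>n. c n \<in> {1, 2, 3}) \<longrightarrow> spiro_chain c (G c)"
proof -
  define w :: "(nat \<Rightarrow> nat) \<Rightarrow> nat \<Rightarrow> nat"
    where "w = (\<lambda>c n. case n of 0 \<Rightarrow> 0 | Suc 0 \<Rightarrow> 0 | Suc m \<Rightarrow> 5 * m + c n)"
  define vs where "vs = (\<lambda>c n. [w c n, 5 * n + 1, 5 * n + 2, 5 * n + 3, 5 * n + 4, 5 * n + 5])"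
  define G where "G = (\<lambda>c. rec_nat (hexagon_of []) (\<lambda>n g.
     if n = 0 then hexagon_of (vs c 1) else graph_union g (hexagon_of (vs c (Suc n)))))"
  have "spiro_chain c (G c)" if c: "\<And>n. c n \<in> {1, 2, 3}" for c
  proof -
    have wl: "w c (Suc (Suc m)) = 5 * Suc m + c (Suc (Suc m))" for m by (simp add: w_def)
    have c3: "1 \<le> c n" "c n \<le> 3" for n using c[of n] by auto
    have wle: "w c n \<le> 5 * n" for n
    proof (cases n)
      case (Suc m)
      then show ?thesis using c3[of n] by (cases m) (auto simp: w_def)
    qed (simp add: w_def)
    have dis: "distinct (vs c n)" for n using wle[of n] by (simp add: vs_def)
    have G1: "G c 1 = hexagon_of (vs c 1)" by (simp add: G_def)
    have GS: "G c (Suc n) = graph_union (G c n) (hexagon_of (vs c (Suc n)))" if "n \<ge> 1" for n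
      using that by (simp add: G_def)
    have hex: "hexagon (hexagon_of (vs c n))" for n
      unfolding hexagon_def hexagon_of_def
      by (rule exI[of _ "vs c n"]) (use dis[of n] in \<open>simp add: vs_def\<close>)
    have V: "verts (hexagon_of (vs c n)) = set (vs c n)" for n by (simp add: hexagon_of_def)
    have bound: "verts (G c n) \<subseteq> {..5 * n + 5} \<and> set (vs c n) \<subseteq> verts (G c n)" if "n \<ge> 1" for n
      using that
    proof (induction n rule: dec_induct)
      case base
      show ?case unfolding G1 V using wle[of 1] by (simp add: vs_def)
    next
      case (step n)
      have "set (vs c (Suc n)) \<subseteq> {..5 * Suc n + 5}" using wle[of "Suc n"] by (auto simp: vs_def)
      with step show ?case by (auto simp: GS graph_union_def V)
    qed
    have wn: "w c (Suc m) = vs c m ! c (Suc m)" if "m \<ge> 1" for m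
      using that c[of "Suc m"] by (cases m) (auto simp: w_def vs_def)
    have win: "w c (Suc m) \<in> set (vs c m)" if "m \<ge> 1" for m
      unfolding wn[OF that]
      by (rule nth_mem) (use c3(2)[of "Suc m"] in \<open>simp add: vs_def\<close>)
    have meet: "verts (G c m) \<inter> set (vs c (Suc m)) = {w c (Suc m)}" if "m \<ge> 1" for m
    proof -
      have "verts (G c m) \<subseteq> {..5 * m + 5}" "w c (Suc m) \<in> verts (G c m)"
        using bound[OF that] win[OF that] by auto
      then show ?thesis by (auto simp: vs_def)
    qed
    have dst: "graph_dist (hexagon_of (vs c m)) (w c m) (w c (Suc m)) = c (Suc m)" if "m \<ge> 1" for m
      using dist_hexagon_of[OF dis[of m, unfolded vs_def] c[of "Suc m"]] wn[OF that]
      by (simp add: vs_def)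
    show ?thesis
      unfolding spiro_chain_def
    proof (intro exI[of _ "\<lambda>n. hexagon_of (vs c n)"] exI[of _ "w c"] conjI allI impI)
      fix n :: nat assume "2 \<le> n"
      then obtain m where [simp]: "n = Suc m" and m: "m \<ge> 1" by (cases n) auto
      show "w c n \<in> verts (hexagon_of (vs c (n - 1)))" using win[OF m] by (simp add: V)
      show "verts (G c (n - 1)) \<inter> verts (hexagon_of (vs c n)) = {w c n}" using meet[OF m] by (simp add: V)
      show "G c n = graph_union (G c (n - 1)) (hexagon_of (vs c n))" using GS[OF m] by simp
    next
      fix n :: nat assume "3 \<le> n"
      then obtain m where [simp]: "n = Suc m" and m: "m \<ge> 1" by (cases n) auto
      show "graph_dist (hexagon_of (vs c (n - 1))) (w c (n - 1)) (w c n) = c n"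
        using dst[OF m] by simp
    qed (use hex G1 in auto)
  qed
  then show ?thesis by (intro exI[of _ G] allI impI) simp
qed

lemma random_spiro_chain_exists:
  assumes "0 < p\<^sub>1" "0 < p\<^sub>2" "0 < p\<^sub>3" "p\<^sub>1 + p\<^sub>2 + p\<^sub>3 = 1"
  shows "\<exists>(M :: (nat \<Rightarrow> nat) measure) (RSC :: nat \<Rightarrow> (nat \<Rightarrow> nat) \<Rightarrow> nat sgraph).
           random_spiro_chain M p\<^sub>1 p\<^sub>2 p\<^sub>3 RSC"
proof -
  define p where "p = (\<lambda>i::nat. if i = 1 then p\<^sub>1 else if i = 2 then p\<^sub>2 else p\<^sub>3)"
  define N where "N = point_measure {1, 2, 3::nat} (\<lambda>i. ennreal (p i))"
  have emN: "emeasure N {i} = ennreal (p i)" if "i \<in> {1, 2, 3}" for i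
    unfolding N_def using that by (subst emeasure_point_measure_finite) auto
  have spN: "space N = {1, 2, 3}" by (simp add: N_def space_point_measure)
  have seN: "sets N = sets (count_space {1, 2, 3})" by (simp add: N_def sets_point_measure)
  have "emeasure N (space N) = ennreal (\<Sum>i\<in>{1, 2, 3}. p i)"
    unfolding spN unfolding N_def using assms
    by (subst emeasure_point_measure_finite) (auto simp: p_def sum_ennreal)
  also have "\<dots> = 1" using assms by (simp add: p_def add.assoc)
  finally interpret N: prob_space N by (rule prob_spaceI)
  define M where "M = PiM (UNIV :: nat set) (\<lambda>_. N)"
  interpret P: product_prob_space "\<lambda>_. N" "UNIV :: nat set" ..
  interpret M: prob_space M unfolding M_def by (rule P.P.prob_space_axioms)
  have rv: "(\<lambda>\<omega>. \<omega> n) \<in> measurable M (count_space {1, 2, 3})" for n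
    unfolding M_def measurable_cong_sets[OF refl seN[symmetric]]
    by (rule measurable_component_singleton) simp
  have comp: "distr M (count_space {1, 2, 3}) (\<lambda>\<omega>. \<omega> n) = N" for n
  proof -
    have "distr M (count_space {1, 2, 3}) (\<lambda>\<omega>. \<omega> n) = distr M N (\<lambda>\<omega>. \<omega> n)"
      by (intro distr_cong) (simp_all add: seN)
    also have "\<dots> = N" unfolding M_def by (rule P.PiM_component) simp
    finally show ?thesis .
  qed
  have sM: "sets (PiM (UNIV :: nat set) (\<lambda>_. count_space {1, 2, 3::nat})) = sets M"
    unfolding M_def by (intro sets_PiM_cong) (simp_all add: seN)
  have "distr M (PiM UNIV (\<lambda>_. count_space {1, 2, 3})) (\<lambda>x. \<lambda>i\<in>UNIV. x i) = distr M M (\<lambda>x. x)"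
    by (intro distr_cong) (simp_all only: sM restrict_UNIV)
  also have "\<dots> = PiM UNIV (\<lambda>i. distr M (count_space {1, 2, 3}) (\<lambda>\<omega>. \<omega> i))"
    unfolding comp by (simp add: M_def)
  finally have "M.indep_vars (\<lambda>_. count_space {1, 2, 3}) (\<lambda>i \<omega>. \<omega> i) UNIV"
    by (subst M.indep_vars_iff_distr_eq_PiM') (use rv in auto)
  then have ind: "M.indep_vars (\<lambda>_. count_space {1, 2, 3}) (\<lambda>i \<omega>. \<omega> i) {3..}"
    by (rule M.indep_vars_subset) simp
  have pr: "measure M {\<omega>\<in>space M. \<omega> n = i} = p i" if i: "i \<in> {1, 2, 3}" for n i
  proof -
    have "p i = measure N {i}" using emN[OF i] assms by (simp add: measure_def p_def)
    also have "\<dots> = measure (distr M (count_space {1, 2, 3}) (\<lambda>\<omega>. \<omega> n)) {i}"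
      unfolding comp ..
    also have "\<dots> = measure M ((\<lambda>\<omega>. \<omega> n) -` {i} \<inter> space M)"
      by (rule measure_distr[OF rv]) (use i in auto)
    also have "(\<lambda>\<omega>. \<omega> n) -` {i} \<inter> space M = {\<omega>\<in>space M. \<omega> n = i}" by auto
    finally show ?thesis by simp
  qed
  obtain R :: "(nat \<Rightarrow> nat) \<Rightarrow> nat \<Rightarrow> nat sgraph"
    where R: "\<forall>c. (\<forall>n. c n \<in> {1, 2, 3}) \<longrightarrow> spiro_chain c (R c)"
    using spiro_chain_exists by (rule exE)
  have ch: "spiro_chain \<omega> (R \<omega>)" if "\<omega> \<in> space M" for \<omega>
    using that by (intro R[rule_format]) (auto simp: M_def space_PiM spN PiE_iff)
  have "random_spiro_chain M p\<^sub>1 p\<^sub>2 p\<^sub>3 (\<lambda>n \<omega>. R \<omega> n)"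
    unfolding random_spiro_chain_def
    by (intro conjI M.prob_space_axioms exI[of _ "\<lambda>i \<omega>. \<omega> i"] ind allI impI ballI)
      (use pr ch in \<open>simp_all add: p_def\<close>)
  then show ?thesis by blast
qed

end

theory Submission
  imports Defs
begin

text \<open>
  Attaching a hexagon to a spiro chain changes the second Zagreb index by an amount that depends
  only on whether case \<open>1\<close> is chosen. The attachment vertex has degree \<open>2\<close> beforehand and \<open>4\<close>
  afterwards; so the new edges always contribute \<open>4 * 4 + 2 * 8 = 32\<close>, and each of the two old edges at
  this vertex gains twice the degree of its other end. That degree is \<open>2\<close>, unless the other end is the
  vertex where the last hexagon was attached itself, which has degree \<open>4\<close>; this happens exactly in
  case \<open>1\<close>, when the two attachment vertices are adjacent. Hence the index grows by \<open>44\<close> in case \<open>1\<close> and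
  by \<open>40\<close> in the other cases, which gives the deterministic formula \<open>second_zagreb_spiro_chain\<close>:
  apart from \<open>40 * n - 16\<close> the index is four times the number \<open>X\<close> of occurrences of case \<open>1\<close>.

  The choices are independent, so \<open>X\<close> counts successes among \<open>n - 2\<close> independent events of
  probability \<open>p\<^sub>1\<close> and is binomially distributed (\<open>distr_count_successes\<close>). Expectation and
  variance of the index follow from those of the binomial distribution. An affine transformation with
  positive slope does not change the standardised variable, so asymptotic normality is that of \<open>X\<close>,
  the theorem of de Moivre and Laplace.
\<close>

section \<open>The hexagon\<close>

lemma hexagon_explicit:
  assumes "hexagon H"
  obtains x0 x1 x2 x3 x4 x5 where "distinct [x0, x1, x2, x3, x4, x5]"
    "verts H = {x0, x1, x2, x3, x4, x5}"
    "edges H = {{x0, x1}, {x1, x2}, {x2, x3}, {x3, x4}, {x4, x5}, {x5, x0}}"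
proof -
  from assms obtain vs where vs: "length vs = 6" "distinct vs" "verts H = set vs"
    "edges H = {{vs ! i, vs ! ((i + 1) mod 6)} | i. i < 6}"
    unfolding hexagon_def by blast
  from vs(1) obtain x0 x1 x2 x3 x4 x5 where x: "vs = [x0, x1, x2, x3, x4, x5]"
    by (auto simp: numeral_eq_Suc length_Suc_conv)
  have "edges H = (\<lambda>i. {vs ! i, vs ! ((i + 1) mod 6)}) ` {i. i < 6}"
    by (auto simp: vs(4))
  also have "{i::nat. i < 6} = {0, 1, 2, 3, 4, 5}" by auto
  finally show thesis using that[of x0 x1 x2 x3 x4 x5] vs(2,3) by (simp add: x)
qed

lemma card_edges_hexagon:
  assumes "hexagon H"
  shows "finite (edges H)" "card (edges H) = 6"
proof -
  from assms obtain x0 x1 x2 x3 x4 x5 where d: "distinct [x0, x1, x2, x3, x4, x5]"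
    and E: "edges H = {{x0, x1}, {x1, x2}, {x2, x3}, {x3, x4}, {x4, x5}, {x5, x0}}"
    by (rule hexagon_explicit)
  show "finite (edges H)" by (simp add: E)
  show "card (edges H) = 6" using d by (auto simp: E doubleton_eq_iff)
qed

lemma degree_hexagon:
  assumes "hexagon H" "v \<in> verts H"
  shows "degree H v = 2"
proof -
  from assms(1) obtain x0 x1 x2 x3 x4 x5 where d: "distinct [x0, x1, x2, x3, x4, x5]"
    and V: "verts H = {x0, x1, x2, x3, x4, x5}"
    and E: "edges H = {{x0, x1}, {x1, x2}, {x2, x3}, {x3, x4}, {x4, x5}, {x5, x0}}"
    by (rule hexagon_explicit)
  have inc: "{e \<in> insert a S. v \<in> e} = (if v \<in> a then insert a {e \<in> S. v \<in> e} else {e \<in> S. v \<in> e})"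
    for a S by auto
  have ne: "x0 \<noteq> x1" "x0 \<noteq> x2" "x0 \<noteq> x3" "x0 \<noteq> x4" "x0 \<noteq> x5" "x1 \<noteq> x2" "x1 \<noteq> x3" "x1 \<noteq> x4" "x1 \<noteq> x5"
    "x2 \<noteq> x3" "x2 \<noteq> x4" "x2 \<noteq> x5" "x3 \<noteq> x4" "x3 \<noteq> x5" "x4 \<noteq> x5" using d by auto
  note ne' = ne ne[symmetric]
  from assms(2) show ?thesis
    unfolding V degree_def E inc
    by (elim insertE emptyE) (simp_all add: ne' doubleton_eq_iff)
qed

text \<open>
  Connectedness is what makes the distance in a hexagon meaningful: \<^const>\<open>graph_dist\<close> is an
  unspecified number for vertices that no walk joins. Going round the cycle in the direction of
  increasing index joins any two vertices.
\<close>

lemma hexagon_connected: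
  assumes "hexagon H" "u \<in> verts H" "v \<in> verts H"
  shows "\<exists>k. (u, v) \<in> adj_rel H ^^ k"
proof -
  from assms(1) obtain vs where vs: "length vs = 6" "verts H = set vs"
    "edges H = {{vs ! i, vs ! ((i + 1) mod 6)} | i. i < 6}"
    unfolding hexagon_def by blast
  have step: "(vs ! (m mod 6), vs ! (Suc m mod 6)) \<in> adj_rel H" for m
    unfolding adj_rel_def vs(3) using mod_less_divisor[of 6 m]
    by (auto intro!: exI[of _ "m mod 6"] simp: mod_Suc_eq)
  have walk: "(vs ! (i mod 6), vs ! ((i + k) mod 6)) \<in> adj_rel H ^^ k" for i k
    by (induction k) (use step in auto)
  from assms(2,3) obtain i j where ij: "i < 6" "j < 6" "u = vs ! i" "v = vs ! j"
    by (auto simp: vs in_set_conv_nth)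
  have "(u, v) \<in> adj_rel H ^^ (j + 6 - i)" using walk[of i "j + 6 - i"] ij by simp
  then show ?thesis ..
qed

lemma graph_dist_eq_1_iff:
  assumes "(u, v) \<in> adj_rel G ^^ k" "u \<noteq> v"
  shows "graph_dist G u v = 1 \<longleftrightarrow> {u, v} \<in> edges G"
proof
  assume "graph_dist G u v = 1"
  with LeastI[of "\<lambda>k. (u, v) \<in> adj_rel G ^^ k", OF assms(1)] show "{u, v} \<in> edges G"
    by (simp add: graph_dist_def adj_rel_def)
next
  assume e: "{u, v} \<in> edges G"
  show "graph_dist G u v = 1" unfolding graph_dist_def
  proof (rule Least_equality)
    show "(u, v) \<in> adj_rel G ^^ 1" using e by (simp add: adj_rel_def)
    show "1 \<le> k" if "(u, v) \<in> adj_rel G ^^ k" for k using that assms(2) by (cases k) auto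
  qed
qed

lemma graph_dist_refl: "graph_dist G v v = 0"
  unfolding graph_dist_def by (rule Least_eq_0) simp

section \<open>Gluing a hexagon to a graph at one vertex\<close>

lemma simple_graphD:
  assumes "simple_graph G"
  shows "finite (edges G)" "e \<in> edges G \<Longrightarrow> e \<subseteq> verts G" "e \<in> edges G \<Longrightarrow> card e = 2"
    "e \<in> edges G \<Longrightarrow> finite e"
proof -
  show "e \<in> edges G \<Longrightarrow> e \<subseteq> verts G" "e \<in> edges G \<Longrightarrow> card e = 2" for e
    using assms by (auto simp: simple_graph_def)
  then show "e \<in> edges G \<Longrightarrow> finite e" for e by (metis card.infinite zero_neq_numeral)
  have "edges G \<subseteq> Pow (verts G)" "finite (verts G)" using assms by (auto simp: simple_graph_def)
  then show "finite (edges G)" by (metis finite_Pow_iff finite_subset)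
qed

lemma degree_outside:
  assumes "simple_graph G" "v \<notin> verts G"
  shows "degree G v = 0"
proof -
  have "{e \<in> edges G. v \<in> e} = {}" using assms simple_graphD(2) by fastforce
  then show ?thesis unfolding degree_def by (metis card.empty)
qed

text \<open>
  A common edge would have both of its ends in the single common vertex.
\<close>

lemma edges_disjoint_glue:
  assumes "simple_graph G" "simple_graph H" "verts G \<inter> verts H = {w}"
  shows "edges G \<inter> edges H = {}"
proof (rule ccontr)
  assume "edges G \<inter> edges H \<noteq> {}"
  then obtain e where e: "e \<in> edges G" "e \<in> edges H" by auto
  then have "e \<subseteq> {w}" using simple_graphD(2) assms by blast
  then have "card e \<le> 1" by (metis card_mono card.empty card.insert empty_iff finite.simps One_nat_def)
  with simple_graphD(3)[OF assms(1) e(1)] show False by simp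
qed

text \<open>
  Since a vertex outside a graph has degree \<open>0\<close> in it, one formula covers the common vertex and all
  others.
\<close>

lemma degree_glue:
  assumes "simple_graph G" "simple_graph H" "verts G \<inter> verts H = {w}"
  shows "degree (graph_union G H) v = degree G v + degree H v"
proof -
  have "{e \<in> edges (graph_union G H). v \<in> e} = {e \<in> edges G. v \<in> e} \<union> {e \<in> edges H. v \<in> e}"
    by (auto simp: graph_union_def)
  then show ?thesis unfolding degree_def
    using edges_disjoint_glue[OF assms] simple_graphD(1)[OF assms(1)] simple_graphD(1)[OF assms(2)]
    by (subst card_Un_disjoint[symmetric]) auto
qed

text \<open>
  The sum of the degrees of the neighbours of \<open>w\<close>. It runs over the edges at \<open>w\<close>, the product
  picking out the other end, so that it matches the terms of the second Zagreb index.
\<close>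

definition nbr_degree_sum :: "'v sgraph \<Rightarrow> 'v \<Rightarrow> nat" where
  "nbr_degree_sum G w = (\<Sum>e\<in>{e \<in> edges G. w \<in> e}. \<Prod>v\<in>e - {w}. degree G v)"

text \<open>
  Among the old vertices only \<open>w\<close> gains degree, by \<open>2\<close>, so each old edge from \<open>w\<close> to a vertex of degree
  \<open>d\<close> gains \<open>2 d\<close>. Of the six new edges, four join vertices of degree \<open>2\<close> and the two at \<open>w\<close>
  contribute \<open>2 (degree G w + 2)\<close> each.
\<close>

lemma second_zagreb_glue_hexagon:
  assumes G: "simple_graph G" and H: "hexagon H" and w: "verts G \<inter> verts H = {w}"
  shows "second_zagreb (graph_union G H) =
    second_zagreb G + 24 + 4 * degree G w + 2 * nbr_degree_sum G w"
proof -
  note H' = hexagon_simple[OF H]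
  let ?d = "degree (graph_union G H)"
  have dG: "?d v = degree G v + (if v = w then 2 else 0)" if "v \<in> verts G" for v
    using degree_glue[OF G H' w, of v] degree_hexagon[OF H, of v] degree_outside[OF H', of v] that w
    by (auto split: if_splits)
  have dH: "?d v = 2 + (if v = w then degree G w else 0)" if "v \<in> verts H" for v
    using degree_glue[OF G H' w, of v] degree_hexagon[OF H that] degree_outside[OF G, of v] that w
    by (auto split: if_splits)
  have eG: "(\<Prod>v\<in>e. ?d v) = (\<Prod>v\<in>e. degree G v) + (if w \<in> e then 2 * (\<Prod>v\<in>e - {w}. degree G v) else 0)"
    if e: "e \<in> edges G" for e
  proof -
    have sub: "e \<subseteq> verts G" and fin: "finite e" using simple_graphD[OF G] e by auto
    have same: "(\<Prod>v\<in>e - {w}. ?d v) = (\<Prod>v\<in>e - {w}. degree G v)"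
      by (rule prod.cong) (use sub dG in auto)
    show ?thesis
    proof (cases "w \<in> e")
      case True
      then have "?d w = degree G w + 2" using dG sub by auto
      then show ?thesis using True same by (simp add: prod.remove[OF fin True] algebra_simps)
    qed (use same in simp)
  qed
  have eH: "(\<Prod>v\<in>e. ?d v) = 4 + (if w \<in> e then 2 * degree G w else 0)"
    if e: "e \<in> edges H" for e
  proof -
    obtain a b where ab: "e = {a, b}" "a \<noteq> b"
      using simple_graphD(3)[OF H' e] by (auto simp: card_2_iff)
    then have "a \<in> verts H" "b \<in> verts H" using simple_graphD(2)[OF H' e] by auto
    then show ?thesis using ab by (auto simp: dH)
  qed
  note fin = simple_graphD(1)[OF G] simple_graphD(1)[OF H']
  have "second_zagreb (graph_union G H) = (\<Sum>e\<in>edges G. \<Prod>v\<in>e. ?d v) + (\<Sum>e\<in>edges H. \<Prod>v\<in>e. ?d v)"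
    unfolding second_zagreb_def
    by (subst sum.union_disjoint[symmetric, OF fin edges_disjoint_glue[OF G H' w]])
      (simp add: graph_union_def)
  also have "(\<Sum>e\<in>edges G. \<Prod>v\<in>e. ?d v) = second_zagreb G + 2 * nbr_degree_sum G w"
    using fin(1) by (simp add: eG sum.distrib second_zagreb_def nbr_degree_sum_def sum.If_cases
        sum_distrib_left Collect_conj_eq)
  also have "(\<Sum>e\<in>edges H. \<Prod>v\<in>e. ?d v) = 4 * card (edges H) + 2 * degree G w * degree H w"
    using fin(2) unfolding degree_def[of H]
    by (simp add: eH sum.distrib sum.If_cases Collect_conj_eq)
  also have "\<dots> = 24 + 4 * degree G w"
    using card_edges_hexagon[OF H] degree_hexagon[OF H, of w] w by auto
  finally show ?thesis by simp
qed

lemma second_zagreb_hexagon: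
  assumes "hexagon H"
  shows "second_zagreb H = 24"
proof -
  have "(\<Prod>v\<in>e. degree H v) = 4" if e: "e \<in> edges H" for e
  proof -
    note S = simple_graphD[OF hexagon_simple[OF assms]]
    have "(\<Prod>v\<in>e. degree H v) = (\<Prod>v\<in>e. 2)"
      using S(2)[OF e] degree_hexagon[OF assms] by (intro prod.cong) auto
    then show ?thesis using S(3)[OF e] by simp
  qed
  then show ?thesis using card_edges_hexagon[OF assms] by (simp add: second_zagreb_def)
qed

text \<open>
  The two neighbours of \<open>w\<close> lie in the hexagon and have degree \<open>2\<close> in \<open>G\<close>, except that \<open>z\<close>, if it is one of them,
  has the excess \<open>k\<close>. In a chain, \<open>z\<close> is the vertex at which the hexagon itself was attached, and
  \<open>k = 2\<close>; the first hexagon of a chain has no such vertex and is covered by \<open>k = 0\<close>.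
\<close>

lemma nbr_degree_sum_eq:
  assumes H: "hexagon H" and w: "w \<in> verts H"
    and inc: "{e \<in> edges G. w \<in> e} = {e \<in> edges H. w \<in> e}"
    and deg: "\<And>v. v \<in> verts H \<Longrightarrow> v \<noteq> w \<Longrightarrow> degree G v = 2 + (if v = z then k else 0)"
  shows "nbr_degree_sum G w = 4 + (if {z, w} \<in> edges H then k else 0)"
proof -
  note S = simple_graphD[OF hexagon_simple[OF H]]
  let ?I = "{e \<in> edges H. w \<in> e}"
  have fin: "finite ?I" using S(1) by simp
  have "(\<Prod>v\<in>e - {w}. degree G v) = 2 + (if e = {z, w} then k else 0)" if e: "e \<in> ?I" for e
  proof -
    obtain v where v: "e = {w, v}" "v \<noteq> w"
      using e S(3)[of e] by (auto simp: card_2_iff)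
    then have "v \<in> verts H" using S(2)[of e] e by auto
    with v deg[of v] have "(\<Prod>v\<in>e - {w}. degree G v) = 2 + (if v = z then k else 0)" by simp
    moreover have "v = z \<longleftrightarrow> e = {z, w}" using v by (auto simp: doubleton_eq_iff)
    ultimately show ?thesis by simp
  qed
  then have "nbr_degree_sum G w = (\<Sum>e\<in>?I. 2 + (if e = {z, w} then k else 0))"
    unfolding nbr_degree_sum_def inc by (rule sum.cong[OF refl])
  also have "\<dots> = 2 * degree H w + (if {z, w} \<in> edges H then k else 0)"
    using fin unfolding sum.distrib degree_def by simp
  finally show ?thesis using degree_hexagon[OF H w] by simp
qed

section \<open>The second Zagreb index of a spiro chain\<close>

text \<open>
  For \<open>n \<ge> 3\<close>, the vertex \<open>w n\<close> at which the \<open>n\<close>-th hexagon is attached has degree \<open>2\<close>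
  so far, because it differs from \<open>w (n - 1)\<close>, the only vertex that the last hexagon shares with the earlier ones. Its two
  neighbours lie in the last hexagon, and one of them is \<open>w (n - 1)\<close>, of degree \<open>4\<close>, exactly if the
  two attachment vertices are at distance \<open>1\<close>. By \<open>second_zagreb_glue_hexagon\<close> the index therefore grows by
  \<open>24 + 4 * 2 + 2 * 6 = 44\<close> in case \<open>1\<close> and by \<open>24 + 4 * 2 + 2 * 4 = 40\<close> otherwise, starting from
  the value \<open>64 = 40 * 2 - 16\<close> for two hexagons.
\<close>

theorem second_zagreb_spiro_chain:
  assumes chain: "spiro_chain c G" and c: "\<And>n. n \<ge> 3 \<Longrightarrow> c n \<noteq> 0" and "n \<ge> 2"
  shows "second_zagreb (G n) + 16 = 4 * card {i \<in> {3..n}. c i = 1} + 40 * n"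
proof -
  from chain obtain H w where hex: "\<And>n. n \<ge> 1 \<Longrightarrow> hexagon (H n)" and G1: "G 1 = H 1"
    and w: "\<And>n. n \<ge> 2 \<Longrightarrow> w n \<in> verts (H (n - 1))"
    and meet: "\<And>n. n \<ge> 2 \<Longrightarrow> verts (G (n - 1)) \<inter> verts (H n) = {w n}"
    and glue: "\<And>n. n \<ge> 2 \<Longrightarrow> G n = graph_union (G (n - 1)) (H n)"
    and dist: "\<And>n. n \<ge> 3 \<Longrightarrow> graph_dist (H (n - 1)) (w (n - 1)) (w n) = c n"
    unfolding spiro_chain_def by metis
  note simple = spiro_chain_simple[OF chain]
  have growth: "second_zagreb (G (Suc m)) =
      second_zagreb (G m) + 24 + 4 * degree (G m) (w (Suc m)) + 2 * nbr_degree_sum (G m) (w (Suc m))"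
    if "m \<ge> 1" for m
    using second_zagreb_glue_hexagon[OF simple hex meet[of "Suc m", simplified]] glue[of "Suc m"] that
    by simp
  have w2: "w 2 \<in> verts (H 1)" using w[of 2] by simp
  \<comment> \<open>The first two hexagons need separate treatment, as nothing was attached to \<open>H 1\<close> before.\<close>
  have deg2: "degree (G 1) (w 2) = 2" using degree_hexagon[OF hex w2] G1 by simp
  have ne: "w n \<noteq> w (n - 1)" if "n \<ge> 3" for n
    using dist[OF that] c[OF that] graph_dist_refl[of "H (n - 1)" "w n"] by auto
  have degree_attach: "degree (G (n - 1)) (w n) = 2" if "n \<ge> 2" for n
  proof (cases "n = 2")
    case False
    with that have n: "n \<ge> 3" by simp
    define m where "m = n - 1"
    have m: "m \<ge> 2" "n - 1 = m" using n by (auto simp: m_def)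
    have wH: "w n \<in> verts (H m)" using w[of n] n m by simp
    have "w n \<notin> verts (G (m - 1))" using meet[of m] m wH ne[OF n] by auto
    then have "degree (G (m - 1)) (w n) = 0" using degree_outside[OF simple] m by simp
    moreover have "degree (H m) (w n) = 2" using degree_hexagon[OF hex wH] m by simp
    ultimately show ?thesis
      using degree_glue[OF simple hexagon_simple[OF hex] meet, of m "w n"] glue[of m] m by simp
  qed (use deg2 in simp)
  have nbr: "nbr_degree_sum (G (n - 1)) (w n) = (if c n = 1 then 6 else 4)" if n: "n \<ge> 3" for n
  proof -
    define m where "m = n - 1"
    have m: "m \<ge> 2" "n - 1 = m" using n by (auto simp: m_def)
    have simple': "simple_graph (G (m - 1))" and hex': "hexagon (H m)" using simple hex m by auto
    have wH: "w n \<in> verts (H m)" using w[of n] n m by simp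
    have wH': "w m \<in> verts (H m)" using meet[of m] m by auto
    have ne': "w m \<noteq> w n" using ne[OF n] m by simp
    have out: "w n \<notin> verts (G (m - 1))" using meet[OF m(1)] wH ne' by (metis IntI singletonD)
    have inc: "{e \<in> edges (G m). w n \<in> e} = {e \<in> edges (H m). w n \<in> e}"
      using glue[of m] m out simple_graphD(2)[OF simple'] by (auto simp: graph_union_def)
    have "degree (G m) v = 2 + (if v = w m then 2 else 0)" if "v \<in> verts (H m)" for v
    proof -
      have "degree (G m) v = degree (G (m - 1)) v + 2"
        using degree_glue[OF simple' hexagon_simple[OF hex'] meet, of v] glue[of m] m
          degree_hexagon[OF hex' that] by simp
      moreover have "degree (G (m - 1)) v = (if v = w m then 2 else 0)"
        using degree_attach[of m] degree_outside[OF simple', of v] meet[of m] m that by auto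
      ultimately show ?thesis by simp
    qed
    \<comment> \<open>The exceptional vertex of \<open>H m\<close> is \<open>w m\<close>, with two edges from earlier hexagons.\<close>
    from nbr_degree_sum_eq[OF hex' wH inc this]
    have "nbr_degree_sum (G m) (w n) = (if {w m, w n} \<in> edges (H m) then 6 else 4)" by simp
    moreover obtain k where k: "(w m, w n) \<in> adj_rel (H m) ^^ k"
      using hexagon_connected[OF hex' wH' wH] by auto
    ultimately show ?thesis using graph_dist_eq_1_iff[OF k ne'] dist[OF n] m by simp
  qed
  show ?thesis using \<open>n \<ge> 2\<close>
  proof (induction n rule: dec_induct)
    case base
    \<comment> \<open>Excess \<open>0\<close> expresses that \<open>H 1\<close> has no exceptional vertex.\<close>
    have "nbr_degree_sum (G 1) (w 2) = 4"
      using nbr_degree_sum_eq[OF hex w2, of "G 1" "w 2" 0] degree_hexagon[OF hex, of 1] G1 by simp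
    then show ?case
      using growth[of 1] deg2 second_zagreb_hexagon[OF hex, of 1] G1 by (simp add: numeral_2_eq_2)
  next
    case (step n)
    have "{i \<in> {3..Suc n}. c i = 1} =
        (if c (Suc n) = 1 then insert (Suc n) {i \<in> {3..n}. c i = 1} else {i \<in> {3..n}. c i = 1})"
      using step(1) by (auto simp: le_Suc_eq)
    then have "card {i \<in> {3..Suc n}. c i = 1} =
        card {i \<in> {3..n}. c i = 1} + (if c (Suc n) = 1 then 1 else 0)" by simp
    then show ?case
      using step nbr[of "Suc n"] degree_attach[of "Suc n"] growth[of n] by simp
  qed
qed

section \<open>Counting independent events\<close>

text \<open>
  The event of exactly \<open>k\<close> successes splits into the disjoint events \<open>E T\<close> that the successes are
  exactly those in \<open>T\<close>, one for each \<open>k\<close>-element set \<open>T\<close>. By independence each has probability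
  \<open>p ^ k * (1 - p) ^ (card A - k)\<close>.
\<close>

lemma (in prob_space) distr_count_successes:
  fixes b :: "'i \<Rightarrow> 'a \<Rightarrow> bool"
  assumes ind: "indep_vars (\<lambda>_. count_space UNIV) b A" and fin: "finite A"
    and p: "\<And>i. i \<in> A \<Longrightarrow> prob {\<omega> \<in> space M. b i \<omega>} = p" "p \<in> {0..1}"
  shows "(\<lambda>\<omega>. card {i \<in> A. b i \<omega>}) \<in> measurable M (count_space UNIV)" (is "?X \<in> _")
    and "distr M (count_space UNIV) (\<lambda>\<omega>. card {i \<in> A. b i \<omega>}) = measure_pmf (binomial_pmf (card A) p)"
proof -
  have rv [measurable]: "b i \<in> measurable M (count_space UNIV)" if "i \<in> A" for i
    using ind that by (auto simp: indep_vars_def)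
  define E where "E T = {\<omega> \<in> space M. \<forall>i\<in>A. b i \<omega> \<longleftrightarrow> i \<in> T}" for T
  have E: "E T \<in> events" for T
    unfolding E_def using fin by measurable
  have E_iff: "\<omega> \<in> E T \<longleftrightarrow> \<omega> \<in> space M \<and> {i \<in> A. b i \<omega>} = T" if "T \<subseteq> A" for T \<omega>
    using that by (auto simp: E_def)
  have probE: "prob (E T) = p ^ card T * (1 - p) ^ (card A - card T)" if T: "T \<subseteq> A" for T
  proof (cases "A = {}")
    case True
    then show ?thesis using T by (simp add: E_def prob_space)
  next
    case False
    have f: "prob {\<omega> \<in> space M. \<not> b i \<omega>} = 1 - p" if "i \<in> A" for i
      using prob_neg[of "b i"] p(1)[OF that] rv[OF that] that by simp
    have "E T = (\<Inter>i\<in>A. b i -` {i \<in> T} \<inter> space M)"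
      using False by (auto simp: E_def)
    also have "prob \<dots> = (\<Prod>i\<in>A. prob (b i -` {i \<in> T} \<inter> space M))"
      by (rule indep_varsD_finite[OF ind False fin]) auto
    also have "\<dots> = (\<Prod>i\<in>A. if i \<in> T then p else 1 - p)"
    proof (rule prod.cong[OF refl])
      fix i assume i: "i \<in> A"
      have "b i -` {i \<in> T} \<inter> space M = {\<omega> \<in> space M. b i \<omega> \<longleftrightarrow> i \<in> T}" by auto
      then show "prob (b i -` {i \<in> T} \<inter> space M) = (if i \<in> T then p else 1 - p)"
        using p(1)[OF i] f[OF i] by simp
    qed
    also have "\<dots> = p ^ card T * (1 - p) ^ card (A - T)"
      using T fin by (simp add: prod.If_cases Int_absorb1 Diff_eq)
    finally show ?thesis using T fin by (simp add: card_Diff_subset finite_subset)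
  qed
  have fib: "?X -` {k} \<inter> space M = (\<Union>T\<in>{T. T \<subseteq> A \<and> card T = k}. E T)" for k
    using E_iff by auto
  have finT: "finite {T. T \<subseteq> A \<and> card T = k}" for k using fin by simp
  show X: "?X \<in> measurable M (count_space UNIV)"
    by (rule measurable_count_space_eq2_countable[THEN iffD2]) (use fib E finT in auto)
  show "distr M (count_space UNIV) ?X = measure_pmf (binomial_pmf (card A) p)"
  proof (rule measure_eqI_countable[where A = UNIV])
    fix k :: nat
    have disj: "disjoint_family_on E {T. T \<subseteq> A \<and> card T = k}"
    proof (unfold disjoint_family_on_def, intro ballI impI)
      fix S T assume "S \<in> {T. T \<subseteq> A \<and> card T = k}" "T \<in> {T. T \<subseteq> A \<and> card T = k}" "S \<noteq> T"
      with E_iff[of S] E_iff[of T] show "E S \<inter> E T = {}" by auto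
    qed
    have "prob (?X -` {k} \<inter> space M) = (\<Sum>T\<in>{T. T \<subseteq> A \<and> card T = k}. prob (E T))"
      unfolding fib by (rule finite_measure_finite_Union[OF finT _ disj]) (use E in blast)
    also have "\<dots> = (\<Sum>T\<in>{T. T \<subseteq> A \<and> card T = k}. p ^ k * (1 - p) ^ (card A - k))"
      by (rule sum.cong[OF refl]) (use probE in auto)
    also have "\<dots> = (card A choose k) * (p ^ k * (1 - p) ^ (card A - k))"
      by (simp add: n_subsets[OF fin])
    also have "\<dots> = pmf (binomial_pmf (card A) p) k" using p(2) by simp
    finally show "emeasure (distr M (count_space UNIV) ?X) {k} = emeasure (binomial_pmf (card A) p) {k}"
      by (simp add: emeasure_distr[OF X] emeasure_eq_measure emeasure_pmf_single)
  qed auto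
qed

text \<open>
  The weights of the binomial distribution are the Bernstein polynomials at \<open>p\<close>, whose first two
  factorial moments are known from the proof of the Weierstrass approximation theorem.
\<close>

lemma expectation_binomial_pmf:
  assumes "p \<in> {0..1}"
  shows "measure_pmf.expectation (binomial_pmf n p) real = n * p"
  using sum_k_Bernstein[of n p] assms
  by (simp add: expectation_binomial_pmf' Bernstein_def algebra_simps)

lemma variance_binomial_pmf:
  assumes p: "p \<in> {0..1}"
  shows "measure_pmf.variance (binomial_pmf n p) real = n * p * (1 - p)"
proof -
  let ?E = "measure_pmf.expectation (binomial_pmf n p)"
  have "?E (\<lambda>k. real k * (real k - 1)) = real n * (real n - 1) * p\<^sup>2"
    unfolding sum_kk_Bernstein[symmetric] expectation_binomial_pmf'[OF p]
    by (rule sum.cong) (simp_all add: Bernstein_def)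
  moreover have "?E (\<lambda>k. real k * (real k - 1)) = ?E (\<lambda>k. (real k)\<^sup>2) - ?E real"
    using p by (subst Bochner_Integration.integral_diff[symmetric])
      (auto simp: algebra_simps power2_eq_square)
  ultimately have "?E (\<lambda>k. (real k)\<^sup>2) = real n * (real n - 1) * p\<^sup>2 + n * p"
    by (simp add: expectation_binomial_pmf[OF p])
  then show ?thesis using p
    by (subst measure_pmf.variance_eq)
      (auto simp: expectation_binomial_pmf power2_eq_square algebra_simps)
qed

lemma weak_conv_m_offset:
  "weak_conv_m (\<lambda>n. \<mu> (n + k)) \<nu> \<Longrightarrow> weak_conv_m \<mu> \<nu>"
  unfolding weak_conv_m_def weak_conv_def by (blast intro: LIMSEQ_offset)

lemma (in prob_space) indep_vars_reindex:
  assumes "indep_vars N X (h ` I)" "inj_on h I"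
  shows "indep_vars (\<lambda>i. N (h i)) (\<lambda>i. X (h i)) I"
proof -
  have "indep_sets (\<lambda>i. {X (h i) -` A \<inter> space M |A. A \<in> sets (N (h i))}) I"
  proof (rule indep_setsI)
    fix i assume "i \<in> I"
    with assms(1) show "{X (h i) -` A \<inter> space M |A. A \<in> sets (N (h i))} \<subseteq> events"
      by (auto simp: indep_vars_def2)
  next
    fix A J assume J: "J \<noteq> {}" "J \<subseteq> I" "finite J"
      and A: "\<forall>j\<in>J. A j \<in> {X (h j) -` A \<inter> space M |A. A \<in> sets (N (h j))}"
    have inj: "inj_on h J" using assms(2) J(2) by (rule inj_on_subset)
    define A' where "A' = A \<circ> the_inv_into J h"
    have A': "A' (h j) = A j" if "j \<in> J" for j
      using that by (simp add: A'_def the_inv_into_f_f[OF inj])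
    have "prob (\<Inter>k\<in>h ` J. A' k) = (\<Prod>k\<in>h ` J. prob (A' k))"
      by (rule indep_setsD[OF assms(1)[unfolded indep_vars_def2, THEN conjunct2]])
        (use J A A' in auto)
    then show "prob (\<Inter>j\<in>J. A j) = (\<Prod>j\<in>J. prob (A j))"
      using A' by (simp add: prod.reindex[OF inj])
  qed
  then show ?thesis using assms(1) by (auto simp: indep_vars_def2)
qed

text \<open>
  The number of successes is the sum of the indicators of the single events, which are independent
  and identically distributed with mean \<open>p\<close> and variance \<open>p * (1 - p)\<close>, so that the central limit
  theorem applies to them.
\<close>

lemma (in prob_space) de_Moivre_Laplace:
  fixes b :: "nat \<Rightarrow> 'a \<Rightarrow> bool" and p :: real
  assumes ind: "indep_vars (\<lambda>_. count_space UNIV) b UNIV"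
    and p: "\<And>i. prob {\<omega> \<in> space M. b i \<omega>} = p" "0 < p" "p < 1"
  shows "weak_conv_m
    (\<lambda>n. distr M borel (\<lambda>\<omega>. (real (card {i \<in> {..<n}. b i \<omega>}) - n * p) / sqrt (n * p * (1 - p))))
    std_normal_distribution"
proof -
  define Y :: "nat \<Rightarrow> 'a \<Rightarrow> real" where "Y i \<omega> = of_bool (b i \<omega>)" for i \<omega>
  have rv [measurable]: "b i \<in> measurable M (count_space UNIV)" for i
    using ind by (auto simp: indep_vars_def)
  have Y_rv [measurable]: "Y i \<in> borel_measurable M" for i unfolding Y_def by measurable
  have Y_ind: "indep_vars (\<lambda>_. borel) Y UNIV"
    unfolding Y_def[abs_def] using ind by (rule indep_vars_compose2) auto
  have Y_sq: "(Y i \<omega>)\<^sup>2 = Y i \<omega>" for i \<omega> by (simp add: Y_def)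
  have Y_int: "integrable M (Y i)" for i
    by (rule integrable_const_bound[of _ 1]) (auto simp: Y_def)
  have Y_mean: "expectation (Y i) = p" for i
  proof -
    have "expectation (Y i) = expectation (indicat_real {\<omega> \<in> space M. b i \<omega>})"
      by (rule Bochner_Integration.integral_cong) (auto simp: Y_def)
    then show ?thesis using p(1)[of i] by simp
  qed
  have Y_var: "variance (Y i) = p * (1 - p)" for i
  proof -
    have "variance (Y i) = expectation (Y i) - p\<^sup>2"
      using Y_int variance_eq[of "Y i"] unfolding Y_sq Y_mean by simp
    then show ?thesis by (simp add: Y_mean power2_eq_square algebra_simps)
  qed
  have Y_distr: "distr M borel (Y i) = distr (measure_pmf (bernoulli_pmf p)) borel of_bool" for i
  proof -
    have "distr M (count_space UNIV) (b i) = measure_pmf (bernoulli_pmf p)"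
    proof (rule measure_eqI_countable[where A = UNIV])
      fix x
      have "b i -` {x} \<inter> space M = {\<omega> \<in> space M. b i \<omega> = x}" by auto
      moreover have "prob {\<omega> \<in> space M. b i \<omega> = x} = pmf (bernoulli_pmf p) x"
        using p prob_neg[of "b i"] by (cases x) auto
      ultimately show "emeasure (distr M (count_space UNIV) (b i)) {x} = emeasure (bernoulli_pmf p) {x}"
        by (simp add: emeasure_distr emeasure_eq_measure emeasure_pmf_single)
    qed auto
    then show ?thesis unfolding Y_def[abs_def]
      by (subst distr_distr[where f = "b i" and N = "count_space UNIV" and g = of_bool, unfolded comp_def, symmetric]) auto
  qed
  have "weak_conv_m (\<lambda>n. distr M borel (\<lambda>\<omega>. (\<Sum>i<n. Y i \<omega> - p) / sqrt (n * (sqrt (p * (1 - p)))\<^sup>2)))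
      std_normal_distribution"
    by (rule central_limit_theorem[OF Y_ind Y_mean]) (use p Y_sq Y_int Y_var Y_distr in auto)
  moreover have "(\<Sum>i<n. Y i \<omega> - p) = real (card {i \<in> {..<n}. b i \<omega>}) - n * p" for n \<omega>
  proof -
    have "(\<Sum>i<n. Y i \<omega>) = card ({..<n} \<inter> {i. b i \<omega>})" by (simp add: Y_def of_bool_def sum.If_cases)
    also have "{..<n} \<inter> {i. b i \<omega>} = {i \<in> {..<n}. b i \<omega>}" by auto
    finally show ?thesis by (simp add: sum_subtractf)
  qed
  ultimately show ?thesis using p by (simp add: mult.assoc)
qed

section \<open>Random spiro chains\<close>

theorem corollary6:
  fixes M :: "'a measure" and p\<^sub>1 p\<^sub>2 p\<^sub>3 :: real
    and RSC :: "nat \<Rightarrow> 'a \<Rightarrow> 'v sgraph"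
    and M2 :: "nat \<Rightarrow> 'a \<Rightarrow> real"
  assumes p1: "0 < p\<^sub>1" "p\<^sub>1 < 1"
    and p2: "0 < p\<^sub>2" "p\<^sub>2 < 1"
    and p3: "0 < p\<^sub>3" "p\<^sub>3 < 1"
    and psum: "p\<^sub>1 + p\<^sub>2 + p\<^sub>3 = 1"
    and RSC: "random_spiro_chain M p\<^sub>1 p\<^sub>2 p\<^sub>3 RSC"
    and M2: "\<And>n \<omega>. M2 n \<omega> = real (second_zagreb (RSC n \<omega>))"
  shows "(\<forall>n\<ge>2.
      (\<exists>X :: 'a \<Rightarrow> nat. X \<in> measurable M (count_space UNIV) \<and>
         distr M (count_space UNIV) X = measure_pmf (binomial_pmf (n - 2) p\<^sub>1) \<and>
         (\<forall>\<omega>\<in>space M. M2 n \<omega> = 4 * real (X \<omega>) + 40 * real n - 16)) \<and>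
      prob_space.expectation M (M2 n) = (4 * p\<^sub>1 + 40) * real n - 8 * p\<^sub>1 - 16 \<and>
      prob_space.variance M (M2 n) = 16 * p\<^sub>1 * (1 - p\<^sub>1) * (real n - 2)) \<and>
    weak_conv_m
      (\<lambda>n. distr M borel
         (\<lambda>\<omega>. (M2 n \<omega> - prob_space.expectation M (M2 n)) / sqrt (prob_space.variance M (M2 n))))
      std_normal_distribution"
proof -
  from RSC obtain c where "prob_space M"
    and c_ind: "prob_space.indep_vars M (\<lambda>_. count_space {1, 2, 3}) c {3..}"
    and c_prob: "\<And>i. i \<ge> 3 \<Longrightarrow> measure M {\<omega> \<in> space M. c i \<omega> = 1} = p\<^sub>1"
    and chain: "\<And>\<omega>. \<omega> \<in> space M \<Longrightarrow> spiro_chain (\<lambda>n. c n \<omega>) (\<lambda>n. RSC n \<omega>)"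
    unfolding random_spiro_chain_def by blast
  interpret prob_space M by fact
  define b where "b i \<omega> \<longleftrightarrow> c i \<omega> = 1" for i \<omega>
  define X where "X n \<omega> = card {i \<in> {3..n}. b i \<omega>}" for n \<omega>
  have p: "p\<^sub>1 \<in> {0..1}" using p1 by simp
  have b_ind: "indep_vars (\<lambda>_. count_space UNIV) b {3..}"
    unfolding b_def[abs_def] using c_ind by (rule indep_vars_compose2) auto
  have b_prob: "prob {\<omega> \<in> space M. b i \<omega>} = p\<^sub>1" if "i \<ge> 3" for i
    using c_prob[OF that] by (simp add: b_def)
  have M2_X: "M2 n \<omega> = 4 * real (X n \<omega>) + 40 * real n - 16" if "n \<ge> 2" "\<omega> \<in> space M" for n \<omega>
  proof -
    \<comment> \<open>The range of the cases is encoded in the target space of the random variables.\<close>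
    have "c i \<omega> \<noteq> 0" if "i \<ge> 3" for i
    proof -
      have "c i \<in> measurable M (count_space {1, 2, 3})"
        using c_ind that by (auto simp: indep_vars_def2)
      then have "c i \<omega> \<in> {1, 2, 3}" using \<open>\<omega> \<in> space M\<close> by (auto dest: measurable_space)
      then show ?thesis by auto
    qed
    from second_zagreb_spiro_chain[OF chain[OF that(2)] this that(1)]
    have "real (second_zagreb (RSC n \<omega>) + 16) = real (4 * X n \<omega> + 40 * n)"
      by (simp add: X_def b_def)
    then show ?thesis by (simp add: M2)
  qed
  have X_count: "X n \<in> measurable M (count_space UNIV)"
    "distr M (count_space UNIV) (X n) = measure_pmf (binomial_pmf (n - 2) p\<^sub>1)" for n
  proof -
    have ind: "indep_vars (\<lambda>_. count_space UNIV) b {3..n}"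
      using b_ind by (rule indep_vars_subset) auto
    have pr: "prob {\<omega> \<in> space M. b i \<omega>} = p\<^sub>1" if "i \<in> {3..n}" for i using b_prob that by simp
    have card: "card {3..n} = n - 2" by simp
    note count = distr_count_successes[OF ind finite_atLeastAtMost _ p]
    show "X n \<in> measurable M (count_space UNIV)"
      unfolding X_def[abs_def] by (rule count(1)) (rule pr)
    show "distr M (count_space UNIV) (X n) = measure_pmf (binomial_pmf (n - 2) p\<^sub>1)"
      unfolding X_def[abs_def] card[symmetric] by (rule count(2)) (rule pr)
  qed
  have E_X: "expectation (\<lambda>\<omega>. f (X n \<omega>)) = measure_pmf.expectation (binomial_pmf (n - 2) p\<^sub>1) f"
    for n and f :: "nat \<Rightarrow> real"
    using integral_distr[OF X_count(1), of f n] by (simp add: X_count(2))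
  have E_M2: "expectation (M2 n) = (4 * p\<^sub>1 + 40) * real n - 8 * p\<^sub>1 - 16" if n: "n \<ge> 2" for n
  proof -
    have "expectation (M2 n) = expectation (\<lambda>\<omega>. 4 * real (X n \<omega>) + 40 * real n - 16)"
      by (rule Bochner_Integration.integral_cong) (use M2_X[OF n] in auto)
    also have "\<dots> = 4 * (real (n - 2) * p\<^sub>1) + 40 * real n - 16"
      unfolding E_X[of "\<lambda>k. 4 * real k + 40 * real n - 16" n]
      using p by (simp add: expectation_binomial_pmf[OF p])
    finally show ?thesis using n by (simp add: of_nat_diff algebra_simps)
  qed
  have center: "M2 n \<omega> - expectation (M2 n) = 4 * (real (X n \<omega>) - real (n - 2) * p\<^sub>1)"
    if "n \<ge> 2" "\<omega> \<in> space M" for n \<omega>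
    using that by (simp add: M2_X E_M2 of_nat_diff algebra_simps)
  have V_M2: "variance (M2 n) = 16 * p\<^sub>1 * (1 - p\<^sub>1) * real (n - 2)" if n: "n \<ge> 2" for n
  proof -
    have "variance (M2 n) = expectation (\<lambda>\<omega>. 16 * (real (X n \<omega>) - real (n - 2) * p\<^sub>1)\<^sup>2)"
      by (rule Bochner_Integration.integral_cong) (simp_all add: center[OF n] power_mult_distrib del: right_diff_distrib_numeral)
    also have "\<dots> = 16 * measure_pmf.variance (binomial_pmf (n - 2) p\<^sub>1) real"
      unfolding E_X[of "\<lambda>k. 16 * (real k - real (n - 2) * p\<^sub>1)\<^sup>2" n]
      by (simp add: expectation_binomial_pmf[OF p])
    finally show ?thesis by (simp add: variance_binomial_pmf[OF p])
  qed
  \<comment> \<open>The cases start at hexagon \<open>3\<close>, the events of the limit theorem at index \<open>0\<close>; a chain with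
    \<open>n + 2\<close> hexagons corresponds to \<open>n\<close> events.\<close>
  have "range (\<lambda>i::nat. i + 3) = {3..}" by (auto simp: image_iff le_iff_add add.commute)
  then have "indep_vars (\<lambda>_. count_space UNIV) (\<lambda>i. b (i + 3)) UNIV"
    using b_ind indep_vars_reindex[of "\<lambda>_. count_space UNIV" b "\<lambda>i. i + 3" UNIV] by simp
  then have clt: "weak_conv_m
    (\<lambda>n. distr M borel (\<lambda>\<omega>. (real (card {i \<in> {..<n}. b (i + 3) \<omega>}) - n * p\<^sub>1) /
      sqrt (n * p\<^sub>1 * (1 - p\<^sub>1)))) std_normal_distribution"
    by (rule de_Moivre_Laplace) (use b_prob p1 in auto)
  have shift: "card {i \<in> {..<n}. b (i + 3) \<omega>} = X (n + 2) \<omega>" for n \<omega>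
    unfolding X_def
    by (rule bij_betw_same_card[OF bij_betw_byWitness[where f = "\<lambda>i. i + 3" and f' = "\<lambda>i. i - 3"]]) auto
  have "(real (card {i \<in> {..<n}. b (i + 3) \<omega>}) - n * p\<^sub>1) / sqrt (n * p\<^sub>1 * (1 - p\<^sub>1)) =
      (M2 (n + 2) \<omega> - expectation (M2 (n + 2))) / sqrt (variance (M2 (n + 2)))"
    if "\<omega> \<in> space M" for n \<omega>
  proof -
    have sd: "sqrt (variance (M2 (n + 2))) = 4 * sqrt (n * p\<^sub>1 * (1 - p\<^sub>1))"
      using V_M2[of "n + 2"] real_sqrt_mult[of "4\<^sup>2" "n * p\<^sub>1 * (1 - p\<^sub>1)"] by (simp add: mult_ac)
    have "M2 (n + 2) \<omega> - expectation (M2 (n + 2)) = 4 * (real (X (n + 2) \<omega>) - n * p\<^sub>1)"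
      using center[OF _ that, of "n + 2"] by simp
    then show ?thesis unfolding shift sd by (simp only: mult_divide_mult_cancel_left_if) simp
  qed
  then have "weak_conv_m (\<lambda>n. distr M borel
      (\<lambda>\<omega>. (M2 (n + 2) \<omega> - expectation (M2 (n + 2))) / sqrt (variance (M2 (n + 2)))))
      std_normal_distribution"
    using clt by (simp cong: distr_cong)
  then have "weak_conv_m
      (\<lambda>n. distr M borel (\<lambda>\<omega>. (M2 n \<omega> - expectation (M2 n)) / sqrt (variance (M2 n))))
      std_normal_distribution"
    by (rule weak_conv_m_offset)
  then show ?thesis
    using X_count M2_X E_M2 V_M2 by (intro conjI allI impI) (auto simp: of_nat_diff)
qed

end
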